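(* Let $t>1$ be fixed and suppose that the pair $(f_t,g_t)$ of relatively elementary functions of two variables restricts to a self-dynamics over $[r,R]$ with constant $q$. Let initial values $u(\cdot,0),v(0,\cdot):[0,\infty)\to[r+q,R-q]$ with uniformly bounded $C^1$ norms be given: $$\|u_x\|_{C^0([0,\infty)\times\{0\})},\ \|v_s\|_{C^0(\{0\}\times[0,\infty))}\le A<\infty .$$ Let $\tau>0$ satisfy $$\tau\,\mathrm{Lip}_{\bar f_t,\bar g_t}\le\tfrac12,\qquad \tau\le D^{-1}q,\qquad \tau B\le\tfrac14 .$$ Then the solutions $u,v:[0,\infty)\times[0,\infty)\to(0,\infty)$ of $u_s=f_t(v,u)-u$, $v_x=g_t(v,u)-v$ with these initial values satisfy, for all $m=0,1,2,\dots$, $$\Big\|\frac{\partial u}{\partial x}\Big\|_{C^0([0,\infty)\times\{m\})},\ \Big\|\frac{\partial v}{\partial s}\Big\|_{C^0(\{m\}\times[0,\infty))}\le 2^{\tau^{-1}m}(A+2D),$$ $$\Big\|\frac{\partial u}{\partial s}\Big\|_{C^0},\ \Big\|\frac{\partial v}{\partial x}\Big\|_{C^0}\le D .$$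
   Context: A relatively elementary function of two variables is, for fixed $t>1$, a function $f_t:(0,\infty)^2\to(0,\infty)$ of the form $f_t(\bar z)=\dfrac{\sum_{k=1}^m t^{\alpha_k}\bar z^{\bar a_k}}{\sum_{k=1}^l t^{\beta_k}\bar z^{\bar b_k}}$, with $\alpha_k,\beta_k\in\mathbb R$, $\bar a_k,\bar b_k\in\mathbb Q^2$, $\bar z^{\bar a}=z_1^{a^1}z_2^{a^2}$. The pair $(f_t,g_t)$ restricts to a self-dynamics over $[r,R]$ ($0<r<R$) if there is some $0<q<r$ such that for all $a>0$: $f_t(a,b)-b\ge q$ and $g_t(b,a)-b\ge q$ whenever $0<b\le r+q$; $f_t(a,b)-b\le-q$ and $g_t(b,a)-b\le-q$ whenever $b\ge R-q$; and $|f_t(a,b)-b|\le R-r$, $|g_t(b,a)-b|\le R-r$ whenever $r\le b\le R$. The constant $q$ in the claim is this one. Constants, with $f_t=f_t(v,u)$, $g_t=g_t(v,u)$ and all suprema over $(v,u)\in[r,R]^2$: $D=\sup\{|f_t(v,u)-u|,\,|g_t(v,u)-v|\}$; $B=\max(\|(f_t)_u-1\|_{C^0},\|(f_t)_v\|_{C^0},\|(g_t)_v-1\|_{C^0},\|(g_t)_u\|_{C^0})$; $\mathrm{Lip}_{\bar f_t,\bar g_t}$ is the larger of the Lipschitz constants (sup-norm metric) on $[r,R]^2$ of $\bar f_t(v,u)=f_t(v,u)-u$ and $\bar g_t(v,u)=g_t(v,u)-v$. *)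

theory Defs
  imports "HOL-Analysis.Analysis"
begin

text \<open>
  Functions on \<open>(0,\<infinity>)\<^sup>2\<close> are total curried functions; only their values at positive
  arguments matter. The requirements \<open>m \<ge> 1\<close> and \<open>l \<ge> 1\<close> are what makes the
  quotient a well-defined positive number.
\<close>

definition relatively_elementary :: "real \<Rightarrow> (real \<Rightarrow> real \<Rightarrow> real) \<Rightarrow> bool" where
  "relatively_elementary t f \<longleftrightarrow>
    (\<exists>(m::nat) (l::nat) (\<alpha>::nat \<Rightarrow> real) (\<beta>::nat \<Rightarrow> real)
       (a1::nat \<Rightarrow> rat) (a2::nat \<Rightarrow> rat) (b1::nat \<Rightarrow> rat) (b2::nat \<Rightarrow> rat).
       m \<ge> 1 \<and> l \<ge> 1 \<and>
       (\<forall>z1>0. \<forall>z2>0.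
          f z1 z2 =
            (\<Sum>k=1..m. t powr \<alpha> k * (z1 powr of_rat (a1 k) * z2 powr of_rat (a2 k))) /
            (\<Sum>k=1..l. t powr \<beta> k * (z1 powr of_rat (b1 k) * z2 powr of_rat (b2 k)))))"

definition restricts_to_self_dynamics ::
    "(real \<Rightarrow> real \<Rightarrow> real) \<Rightarrow> (real \<Rightarrow> real \<Rightarrow> real) \<Rightarrow> real \<Rightarrow> real \<Rightarrow> real \<Rightarrow> bool" where
  "restricts_to_self_dynamics f g r R q \<longleftrightarrow>
     0 < r \<and> r < R \<and> 0 < q \<and> q < r \<and>
     (\<forall>a>0.
        (\<forall>b. 0 < b \<and> b \<le> r + q \<longrightarrow> f a b - b \<ge> q \<and> g b a - b \<ge> q) \<and>
        (\<forall>b. b \<ge> R - q \<longrightarrow> f a b - b \<le> - q \<and> g b a - b \<le> - q) \<and>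
        (\<forall>b. r \<le> b \<and> b \<le> R \<longrightarrow> \<bar>f a b - b\<bar> \<le> R - r \<and> \<bar>g b a - b\<bar> \<le> R - r))"

text \<open>
  The constants below are real-valued suprema and infima. For relatively elementary
  \<open>f\<close> and \<open>g\<close>, which are smooth on \<open>(0,\<infinity>)\<^sup>2\<close>, and \<open>0 < r < R\<close>, the sets involved
  are nonempty and bounded, so these are the genuine values. The argument order is
  \<open>f v u\<close>, \<open>g v u\<close>.
\<close>

definition D_const ::
    "(real \<Rightarrow> real \<Rightarrow> real) \<Rightarrow> (real \<Rightarrow> real \<Rightarrow> real) \<Rightarrow> real \<Rightarrow> real \<Rightarrow> real" where
  "D_const f g r R =
     Sup ((\<lambda>(v,u). \<bar>f v u - u\<bar>) ` ({r..R} \<times> {r..R}) \<union>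
          (\<lambda>(v,u). \<bar>g v u - v\<bar>) ` ({r..R} \<times> {r..R}))"

definition B_const ::
    "(real \<Rightarrow> real \<Rightarrow> real) \<Rightarrow> (real \<Rightarrow> real \<Rightarrow> real) \<Rightarrow> real \<Rightarrow> real \<Rightarrow> real" where
  "B_const f g r R =
     Max {SUP (v,u)\<in>{r..R} \<times> {r..R}. \<bar>deriv (\<lambda>u'. f v u') u - 1\<bar>,
          SUP (v,u)\<in>{r..R} \<times> {r..R}. \<bar>deriv (\<lambda>v'. f v' u) v\<bar>,
          SUP (v,u)\<in>{r..R} \<times> {r..R}. \<bar>deriv (\<lambda>v'. g v' u) v - 1\<bar>,
          SUP (v,u)\<in>{r..R} \<times> {r..R}. \<bar>deriv (\<lambda>u'. g v u') u\<bar>}"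

text \<open>
  The optimal Lipschitz constant for the sup-norm metric. The library's
  \<open>lipschitz_on\<close> would use the Euclidean metric on the product type instead.
\<close>

definition sup_lipschitz_const :: "(real \<times> real) set \<Rightarrow> (real \<Rightarrow> real \<Rightarrow> real) \<Rightarrow> real" where
  "sup_lipschitz_const S h =
     Inf {L. 0 \<le> L \<and>
        (\<forall>(v,u)\<in>S. \<forall>(v',u')\<in>S. \<bar>h v u - h v' u'\<bar> \<le> L * max \<bar>v - v'\<bar> \<bar>u - u'\<bar>)}"

definition Lip_const ::
    "(real \<Rightarrow> real \<Rightarrow> real) \<Rightarrow> (real \<Rightarrow> real \<Rightarrow> real) \<Rightarrow> real \<Rightarrow> real \<Rightarrow> real" where
  "Lip_const f g r R =
     max (sup_lipschitz_const ({r..R} \<times> {r..R}) (\<lambda>v u. f v u - u))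
         (sup_lipschitz_const ({r..R} \<times> {r..R}) (\<lambda>v u. g v u - v))"

text \<open>
  Derivatives on \<open>[0,\<infinity>)\<close> are one-sided at \<open>0\<close>. The library's \<open>C1_differentiable_on\<close>
  asks for a two-sided derivative at \<open>0\<close>, which would constrain values at negative arguments.
\<close>

definition C1_halfline :: "(real \<Rightarrow> real) \<Rightarrow> bool" where
  "C1_halfline h \<longleftrightarrow>
     (\<exists>h'. continuous_on {0..} h' \<and>
        (\<forall>x\<ge>0. (h has_real_derivative h' x) (at x within {0..})))"

text \<open>
  Partial derivatives on \<open>[0,\<infinity>)\<^sup>2\<close>. They are meaningful only where the derivative exists,
  which is always asserted separately.
\<close>

definition partial_x :: "(real \<Rightarrow> real \<Rightarrow> real) \<Rightarrow> real \<Rightarrow> real \<Rightarrow> real" where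
  "partial_x w x s = vector_derivative (\<lambda>y. w y s) (at x within {0..})"

definition partial_s :: "(real \<Rightarrow> real \<Rightarrow> real) \<Rightarrow> real \<Rightarrow> real \<Rightarrow> real" where
  "partial_s w x s = vector_derivative (\<lambda>y. w x y) (at s within {0..})"

text \<open>Extended-real valued, so that a bound by a real number includes finiteness.\<close>

definition C0_norm :: "(real \<times> real) set \<Rightarrow> (real \<Rightarrow> real \<Rightarrow> real) \<Rightarrow> ereal" where
  "C0_norm S w = (SUP (x,s)\<in>S. ereal \<bar>w x s\<bar>)"

text \<open>
  Positive classical solutions \<open>u = u(x,s)\<close>, \<open>v = v(x,s)\<close> on \<open>[0,\<infinity>)\<^sup>2\<close> of
  \<open>u\<^sub>s = f(v,u) - u\<close>, \<open>v\<^sub>x = g(v,u) - v\<close>. Nothing is assumed about the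
  derivatives of \<open>u\<close> in \<open>x\<close> and of \<open>v\<close> in \<open>s\<close>.
\<close>

definition is_solution ::
    "(real \<Rightarrow> real \<Rightarrow> real) \<Rightarrow> (real \<Rightarrow> real \<Rightarrow> real) \<Rightarrow>
     (real \<Rightarrow> real \<Rightarrow> real) \<Rightarrow> (real \<Rightarrow> real \<Rightarrow> real) \<Rightarrow> bool" where
  "is_solution f g u v \<longleftrightarrow>
     continuous_on ({0..} \<times> {0..}) (\<lambda>(x,s). u x s) \<and>
     continuous_on ({0..} \<times> {0..}) (\<lambda>(x,s). v x s) \<and>
     (\<forall>x\<ge>0. \<forall>s\<ge>0.
        u x s > 0 \<and> v x s > 0 \<and>
        ((\<lambda>s'. u x s') has_real_derivative (f (v x s) (u x s) - u x s)) (at s within {0..}) \<and>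
        ((\<lambda>x'. v x' s) has_real_derivative (g (v x s) (u x s) - v x s)) (at x within {0..}))"

end

theory Submission
  imports Defs
begin

text \<open>
  The self-dynamics inequalities trap \<open>u(x, \<cdot>)\<close> and \<open>v(\<cdot>, s)\<close> in \<open>[r, R]\<close>, which bounds \<open>u\<^sub>s\<close> and
  \<open>v\<^sub>x\<close> by \<open>D\<close>. For fixed \<open>x\<close> the function \<open>u(x, \<cdot>)\<close> solves an ODE in \<open>s\<close> whose right-hand side
  depends on \<open>x\<close> through \<open>v\<close> only, and \<open>v\<close> is \<open>C\<^sup>1\<close> in \<open>x\<close> because \<open>v\<^sub>x\<close> is prescribed by the
  system. Hence \<open>u(x', s) - u(x, s)\<close> is \<open>x' - x\<close> times the solution of a linear ODE whose
  coefficients are integrated derivatives, continuous in \<open>(x', x, s)\<close> including \<open>x' = x\<close>.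
  On the diagonal this gives \<open>p = u\<^sub>x\<close> with \<open>p\<^sub>s = (f\<^sub>u - 1) p + f\<^sub>v v\<^sub>x\<close>, so \<open>u\<^sub>x\<close> grows at
  rate at most \<open>3B/2 \<le> 3/(8\<tau>) < ln 2 / \<tau>\<close>. The bounds for \<open>v\<close> follow by exchanging the
  roles of the two equations.
\<close>

section \<open>Continuity of curried functions along continuous arguments\<close>

lemma continuous_on_compose_uncurry2:
  assumes "continuous_on (X1 \<times> X2) (\<lambda>(a, b). h a b)"
    and "continuous_on T e1" "continuous_on T e2"
    and "\<And>z. z \<in> T \<Longrightarrow> e1 z \<in> X1" "\<And>z. z \<in> T \<Longrightarrow> e2 z \<in> X2"
  shows "continuous_on T (\<lambda>z. h (e1 z) (e2 z))"
proof -
  have "(\<lambda>z. (e1 z, e2 z)) ` T \<subseteq> X1 \<times> X2"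
    using assms(4,5) by blast
  from continuous_on_compose2[OF assms(1) continuous_on_Pair[OF assms(2,3)] this]
  show ?thesis by simp
qed

lemma continuous_on_compose_uncurry3:
  assumes "continuous_on (X1 \<times> X2 \<times> X3) (\<lambda>(a, b, c). h a b c)"
    and "continuous_on T e1" "continuous_on T e2" "continuous_on T e3"
    and "\<And>z. z \<in> T \<Longrightarrow> e1 z \<in> X1" "\<And>z. z \<in> T \<Longrightarrow> e2 z \<in> X2" "\<And>z. z \<in> T \<Longrightarrow> e3 z \<in> X3"
  shows "continuous_on T (\<lambda>z. h (e1 z) (e2 z) (e3 z))"
proof -
  have "(\<lambda>z. (e1 z, e2 z, e3 z)) ` T \<subseteq> X1 \<times> X2 \<times> X3"
    using assms(5-7) by blast
  from continuous_on_compose2[OF assms(1)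
      continuous_on_Pair[OF assms(2) continuous_on_Pair[OF assms(3,4)]] this]
  show ?thesis by simp
qed

lemma continuous_on_swap_args:
  assumes "continuous_on (S \<times> T) (\<lambda>(a, b). w a b)"
  shows "continuous_on (T \<times> S) (\<lambda>(b, a). w a b)"
  unfolding split_beta
  by (rule continuous_on_compose_uncurry2[OF assms]) (auto intro!: continuous_intros)

section \<open>Divided differences with a parameter\<close>

text \<open>Here \<open>\<kappa> c a b\<close> is the mean of \<open>k c\<close> over the segment
  from \<open>b\<close> to \<open>a\<close>. As an integral over the fixed interval
  \<open>{0..1}\<close> it is jointly continuous also at \<open>a = b\<close>, where the difference
  quotient itself is undefined.\<close>

lemma hadamard_divided_difference:
  fixes K k :: "'a::topological_space \<Rightarrow> real \<Rightarrow> real"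
  assumes "convex I"
    and cont: "continuous_on (C \<times> I) (\<lambda>(c, y). k c y)"
    and deriv: "\<And>c y. c \<in> C \<Longrightarrow> y \<in> I \<Longrightarrow> (K c has_real_derivative k c y) (at y within I)"
  obtains \<kappa> where "continuous_on (C \<times> I \<times> I) (\<lambda>(c, a, b). \<kappa> c a b)"
    and "\<And>c a b. c \<in> C \<Longrightarrow> a \<in> I \<Longrightarrow> b \<in> I \<Longrightarrow> K c a - K c b = \<kappa> c a b * (a - b)"
    and "\<And>c a. c \<in> C \<Longrightarrow> a \<in> I \<Longrightarrow> \<kappa> c a a = k c a"
proof -
  define \<kappa> where "\<kappa> c a b = integral {0..1} (\<lambda>\<theta>. k c (b + \<theta> * (a - b)))" for c a b
  have seg: "b + \<theta> * (a - b) \<in> I" if "a \<in> I" "b \<in> I" "\<theta> \<in> {0..1}" for a b \<theta>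
    using convexD[OF \<open>convex I\<close>, of b a "1 - \<theta>" \<theta>] that by (simp add: algebra_simps)
  show ?thesis
  proof (rule that[of \<kappa>])
    have "continuous_on ((C \<times> I \<times> I) \<times> cbox 0 1)
            (\<lambda>(p, \<theta>). k (fst p) (snd (snd p) + \<theta> * (fst (snd p) - snd (snd p))))"
      unfolding split_beta
      by (rule continuous_on_compose_uncurry2[OF cont]) (auto intro!: continuous_intros seg)
    from integral_continuous_on_param[OF this]
    show "continuous_on (C \<times> I \<times> I) (\<lambda>(c, a, b). \<kappa> c a b)"
      by (simp add: \<kappa>_def split_beta)
    fix c a b assume c: "c \<in> C" and a: "a \<in> I" and b: "b \<in> I"
    show "\<kappa> c a a = k c a"
      by (simp add: \<kappa>_def)
    have "((\<lambda>\<theta>. K c (b + \<theta> * (a - b))) has_real_derivative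
            k c (b + \<theta> * (a - b)) * (a - b)) (at \<theta> within {0..1})"
      if "\<theta> \<in> {0..1}" for \<theta>
    proof -
      \<comment> \<open>The chain rule needs the derivative only relative to the image of
        \<open>{0..1}\<close>, which lies in \<open>I\<close> by convexity; one-sided derivatives at
        end points of \<open>I\<close> therefore suffice.\<close>
      have "(K c has_real_derivative k c (b + \<theta> * (a - b)))
              (at (b + \<theta> * (a - b)) within (\<lambda>\<theta>. b + \<theta> * (a - b)) ` {0..1})"
        by (rule DERIV_subset[OF deriv]) (use c a b that seg in auto)
      moreover have "((\<lambda>\<theta>. b + \<theta> * (a - b)) has_real_derivative (a - b)) (at \<theta> within {0..1})"
        by (auto intro!: derivative_eq_intros)
      ultimately show ?thesis
        by (rule DERIV_image_chain[unfolded o_def])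
    qed
    then have "((\<lambda>\<theta>. k c (b + \<theta> * (a - b)) * (a - b)) has_integral K c a - K c b) {0..1}"
      using fundamental_theorem_of_calculus[of 0 1 "\<lambda>\<theta>. K c (b + \<theta> * (a - b))"
          "\<lambda>\<theta>. k c (b + \<theta> * (a - b)) * (a - b)"]
      by (simp add: has_real_derivative_iff_has_vector_derivative)
    then show "K c a - K c b = \<kappa> c a b * (a - b)"
      unfolding \<kappa>_def by (metis integral_mult_left integral_unique)
  qed
qed

section \<open>Linear differential equations on the half-line\<close>

lemma antiderivative_halfline:
  fixes \<alpha> :: "real \<Rightarrow> real"
  assumes "continuous_on {0..} \<alpha>" "0 \<le> s"
  shows "((\<lambda>s. integral {0..s} \<alpha>) has_real_derivative \<alpha> s) (at s within {0..})"
proof -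
  \<comment> \<open>Ending beyond \<open>s\<close> makes \<open>{0..s+1}\<close> and
    \<open>{0..}\<close> agree near \<open>s\<close>, so the derivative is not merely
    left-sided.\<close>
  have "continuous_on {0..s+1} \<alpha>"
    using assms(1) by (rule continuous_on_subset) auto
  then have "((\<lambda>s. integral {0..s} \<alpha>) has_real_derivative \<alpha> s) (at s within {0..s+1})"
    by (rule integral_has_real_derivative) (use assms in auto)
  moreover have "at s within {0..s+1} = at s within {0..}"
    by (rule at_within_nhd[of _ "{..<s+1}"]) auto
  ultimately show ?thesis by simp
qed

text \<open>The upper limit of the integral moves with \<open>s\<close>. The divided difference
  between \<open>s\<close> and \<open>0\<close> is an integral over a fixed interval, so
  \<open>J y s = \<kappa> y s 0 * s\<close> is jointly continuous.\<close>

lemma continuous_antiderivative_param: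
  fixes \<alpha> :: "'a::topological_space \<Rightarrow> real \<Rightarrow> real"
  assumes cont: "continuous_on (Y \<times> {0..}) (\<lambda>(y, s). \<alpha> y s)"
  obtains J where "continuous_on (Y \<times> {0..}) (\<lambda>(y, s). J y s)"
    and "\<And>y. y \<in> Y \<Longrightarrow> J y 0 = 0"
    and "\<And>y s. y \<in> Y \<Longrightarrow> 0 \<le> s \<Longrightarrow> (J y has_real_derivative \<alpha> y s) (at s within {0..})"
proof -
  define J where "J y s = integral {0..s} (\<alpha> y)" for y s
  have cont': "continuous_on {0..} (\<alpha> y)" if "y \<in> Y" for y
    by (rule continuous_on_compose_uncurry2[OF cont]) (use that in \<open>auto intro!: continuous_intros\<close>)
  have J_deriv: "(J y has_real_derivative \<alpha> y s) (at s within {0..})" if "y \<in> Y" "0 \<le> s" for y s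
    using antiderivative_halfline[OF cont' that(2)] that(1) by (simp add: J_def[abs_def])
  obtain \<kappa> where \<kappa>: "continuous_on (Y \<times> {0..} \<times> {0..}) (\<lambda>(c, a, b). \<kappa> c a b)"
    "\<And>c a b. c \<in> Y \<Longrightarrow> a \<in> {0..} \<Longrightarrow> b \<in> {0..} \<Longrightarrow> J c a - J c b = \<kappa> c a b * (a - b)"
    by (rule hadamard_divided_difference[OF _ cont, where K = J]) (auto intro: J_deriv)
  have J_eq: "J y s = \<kappa> y s 0 * s" if "y \<in> Y" "0 \<le> s" for y s
    using \<kappa>(2)[of y s 0] that by (simp add: J_def)
  have "continuous_on (Y \<times> {0..}) (\<lambda>z. \<kappa> (fst z) (snd z) 0)"
    by (rule continuous_on_compose_uncurry3[OF \<kappa>(1)]) (auto intro!: continuous_intros)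
  then have "continuous_on (Y \<times> {0..}) (\<lambda>(y, s). \<kappa> y s 0 * s)"
    by (auto intro!: continuous_intros simp: split_beta)
  then have "continuous_on (Y \<times> {0..}) (\<lambda>(y, s). J y s)"
    by (rule continuous_on_eq) (auto simp: J_eq)
  moreover have "J y 0 = 0" for y
    by (simp add: J_def)
  ultimately show ?thesis
    using that J_deriv by blast
qed

text \<open>Variation of constants: with \<open>I\<close> the antiderivative of
  \<open>\<alpha>\<close> and \<open>J\<close> that of \<open>exp (- I) * \<beta>\<close>, take
  \<open>W = exp I * (c + J)\<close>. The explicit formula makes \<open>W\<close> jointly continuous
  in the parameter and \<open>s\<close>.\<close>

lemma linear_ode_param:
  fixes \<alpha> \<beta> :: "'a::topological_space \<Rightarrow> real \<Rightarrow> real"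
  assumes \<alpha>: "continuous_on (Y \<times> {0..}) (\<lambda>(y, s). \<alpha> y s)"
    and \<beta>: "continuous_on (Y \<times> {0..}) (\<lambda>(y, s). \<beta> y s)"
    and c: "continuous_on Y c"
  obtains W where "continuous_on (Y \<times> {0..}) (\<lambda>(y, s). W y s)"
    and "\<And>y. y \<in> Y \<Longrightarrow> W y 0 = c y"
    and "\<And>y s. y \<in> Y \<Longrightarrow> 0 \<le> s \<Longrightarrow>
           (W y has_real_derivative \<alpha> y s * W y s + \<beta> y s) (at s within {0..})"
proof -
  obtain I where I: "continuous_on (Y \<times> {0..}) (\<lambda>(y, s). I y s)"
      "\<And>y. y \<in> Y \<Longrightarrow> I y 0 = 0"
      "\<And>y s. y \<in> Y \<Longrightarrow> 0 \<le> s \<Longrightarrow> (I y has_real_derivative \<alpha> y s) (at s within {0..})"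
    using continuous_antiderivative_param[OF \<alpha>] by blast
  have "continuous_on (Y \<times> {0..}) (\<lambda>(y, s). exp (- I y s) * \<beta> y s)"
    using I(1) \<beta> by (auto intro!: continuous_intros simp: split_beta)
  then obtain J where J: "continuous_on (Y \<times> {0..}) (\<lambda>(y, s). J y s)"
      "\<And>y. y \<in> Y \<Longrightarrow> J y 0 = 0"
      "\<And>y s. y \<in> Y \<Longrightarrow> 0 \<le> s \<Longrightarrow>
         (J y has_real_derivative exp (- I y s) * \<beta> y s) (at s within {0..})"
    using continuous_antiderivative_param[of Y "\<lambda>y s. exp (- I y s) * \<beta> y s"] by blast
  show ?thesis
  proof (rule that[of "\<lambda>y s. exp (I y s) * (c y + J y s)"])
    have "continuous_on (Y \<times> {0::real..}) (\<lambda>z. c (fst z))"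
      by (rule continuous_on_compose2[OF c]) (auto intro!: continuous_intros)
    then show "continuous_on (Y \<times> {0..}) (\<lambda>(y, s). exp (I y s) * (c y + J y s))"
      using I(1) J(1) by (auto intro!: continuous_intros simp: split_beta)
    fix y assume y: "y \<in> Y"
    show "exp (I y 0) * (c y + J y 0) = c y"
      using I(2) J(2) y by simp
    fix s :: real assume s: "0 \<le> s"
    show "((\<lambda>s. exp (I y s) * (c y + J y s)) has_real_derivative
        \<alpha> y s * (exp (I y s) * (c y + J y s)) + \<beta> y s) (at s within {0..})"
      by (rule derivative_eq_intros I(3)[OF y s] J(3)[OF y s] refl)+
        (simp add: algebra_simps flip: exp_add)
  qed
qed

text \<open>The energy \<open>w\<^sup>2 + D\<^sup>2\<close> grows at rate at most \<open>3 * B\<close>.\<close>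

lemma linear_ode_bound:
  fixes w a b :: "real \<Rightarrow> real"
  assumes "0 \<le> S" "0 \<le> B" "0 \<le> D"
    and deriv: "\<And>s. s \<in> {0..S} \<Longrightarrow> (w has_real_derivative a s * w s + b s) (at s within {0..})"
    and a: "\<And>s. s \<in> {0..S} \<Longrightarrow> \<bar>a s\<bar> \<le> B"
    and b: "\<And>s. s \<in> {0..S} \<Longrightarrow> \<bar>b s\<bar> \<le> B * D"
  shows "\<bar>w S\<bar> \<le> exp (3 / 2 * B * S) * (\<bar>w 0\<bar> + D)"
proof -
  \<comment> \<open>Squaring avoids \<open>\<bar>w s\<bar>\<close>, which may fail to be
    differentiable at zeros of \<open>w\<close>; the summand \<open>D\<^sup>2\<close> absorbs the
    forcing term \<open>b\<close>. The exponential weight turns the growth rate into monotonicity of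
    \<open>z\<close>.\<close>
  define z where "z s = exp (- 3 * B * s) * ((w s)\<^sup>2 + D\<^sup>2)" for s
  have z_deriv: "(z has_real_derivative
       exp (- 3 * B * s) * (2 * w s * (a s * w s + b s) - 3 * B * ((w s)\<^sup>2 + D\<^sup>2)))
       (at s within {0..})" if "s \<in> {0..S}" for s
    unfolding z_def[abs_def]
    by (rule derivative_eq_intros deriv[OF that] refl)+ (simp add: algebra_simps)
  \<comment> \<open>The mixed term is split by
    \<open>2 * \<bar>w s\<bar> * D \<le> (w s)\<^sup>2 + D\<^sup>2\<close>, so \<open>B\<close>
    counts twice through \<open>a\<close> and once through \<open>b\<close>.\<close>
  have neg: "2 * w s * (a s * w s + b s) - 3 * B * ((w s)\<^sup>2 + D\<^sup>2) \<le> 0" if "s \<in> {0..S}" for s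
  proof -
    have "a s * (w s)\<^sup>2 \<le> B * (w s)\<^sup>2"
      using a[OF that] by (intro mult_right_mono) auto
    moreover have "w s * b s \<le> \<bar>w s\<bar> * (B * D)"
      using b[OF that] by (metis abs_ge_self abs_ge_zero abs_mult mult_left_mono order_trans)
    moreover have "B * (2 * \<bar>w s\<bar> * D) \<le> B * ((w s)\<^sup>2 + D\<^sup>2)"
      using sum_squares_bound[of "\<bar>w s\<bar>" D] \<open>0 \<le> B\<close> by (intro mult_left_mono) auto
    moreover have "0 \<le> B * D\<^sup>2" using \<open>0 \<le> B\<close> by simp
    ultimately show ?thesis by (simp add: algebra_simps power2_eq_square)
  qed
  have "z S \<le> z 0"
  proof (rule DERIV_nonpos_imp_decreasing_open[OF \<open>0 \<le> S\<close>])
    fix s assume s: "0 < s" "s < S"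
    have "at s within {0..} = at s"
      by (rule at_within_open_subset[of _ "{0<..}"]) (use s in auto)
    then show "\<exists>y. DERIV z s :> y \<and> y \<le> 0"
      using z_deriv[of s] neg[of s] s by (auto simp: mult_le_0_iff)
  next
    show "continuous_on {0..S} z"
      by (rule DERIV_continuous_on[OF DERIV_subset[OF z_deriv]]) auto
  qed
  then have "(w S)\<^sup>2 + D\<^sup>2 \<le> exp (3 * B * S) * ((w 0)\<^sup>2 + D\<^sup>2)"
    by (simp add: z_def exp_minus field_simps)
  also have "\<dots> \<le> exp (3 * B * S) * (\<bar>w 0\<bar> + D)\<^sup>2"
    using \<open>0 \<le> D\<close> by (intro mult_left_mono) (auto simp: power2_sum)
  \<comment> \<open>The square root taken at the end halves the rate \<open>3 * B\<close>.\<close>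
  also have "\<dots> = (exp (3 / 2 * B * S) * (\<bar>w 0\<bar> + D))\<^sup>2"
    by (simp add: power_mult_distrib flip: exp_double)
  finally have "\<bar>w S\<bar>\<^sup>2 + D\<^sup>2 \<le> (exp (3 / 2 * B * S) * (\<bar>w 0\<bar> + D))\<^sup>2"
    by simp
  then have "\<bar>w S\<bar>\<^sup>2 \<le> (exp (3 / 2 * B * S) * (\<bar>w 0\<bar> + D))\<^sup>2"
    using zero_le_power2[of D] by linarith
  then show ?thesis
    by (rule power2_le_imp_le) (use \<open>0 \<le> D\<close> in auto)
qed

text \<open>The difference of the two solutions solves the homogeneous equation with initial value
  \<open>0\<close>, and the growth estimate with \<open>D = 0\<close> forces it to vanish.
  Compactness of \<open>{0..S}\<close> provides the bound on \<open>a\<close>.\<close>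

lemma linear_ode_unique:
  fixes w1 w2 a b :: "real \<Rightarrow> real"
  assumes "continuous_on {0..} a" and "0 \<le> S" and "w1 0 = w2 0"
    and d1: "\<And>s. 0 \<le> s \<Longrightarrow> (w1 has_real_derivative a s * w1 s + b s) (at s within {0..})"
    and d2: "\<And>s. 0 \<le> s \<Longrightarrow> (w2 has_real_derivative a s * w2 s + b s) (at s within {0..})"
  shows "w1 S = w2 S"
proof -
  have "continuous_on {0..S} a"
    using assms(1) by (rule continuous_on_subset) auto
  then have "bounded (a ` {0..S})"
    by (intro compact_imp_bounded compact_continuous_image) auto
  then obtain B where "0 < B" "\<And>s. s \<in> {0..S} \<Longrightarrow> \<bar>a s\<bar> \<le> B"
    by (auto simp: bounded_pos)
  moreover have "((\<lambda>s. w1 s - w2 s) has_real_derivative a s * (w1 s - w2 s) + 0) (at s within {0..})"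
    if "s \<in> {0..S}" for s
    using DERIV_diff[OF d1 d2, of s] that by (simp add: algebra_simps)
  ultimately have "\<bar>w1 S - w2 S\<bar> \<le> exp (3 / 2 * B * S) * (\<bar>w1 0 - w2 0\<bar> + 0)"
    using \<open>0 \<le> S\<close> by (intro linear_ode_bound[where a = a and b = "\<lambda>_. 0"]) auto
  then show ?thesis using assms(3) by simp
qed

section \<open>Barriers for scalar functions on the half-line\<close>

text \<open>If \<open>w\<close> fell below \<open>c\<close>, its minimum over \<open>{0..S}\<close>
  would be attained at some \<open>m > 0\<close> with \<open>w m < c\<close>. The derivative there
  is positive, so \<open>w\<close> is smaller just left of \<open>m\<close>, a
  contradiction.\<close>

lemma barrier_lower:
  fixes w d :: "real \<Rightarrow> real"
  assumes deriv: "\<And>s. 0 \<le> s \<Longrightarrow> (w has_real_derivative d s) (at s within {0..})"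
    and "c \<le> w 0" and pos: "\<And>s. 0 \<le> s \<Longrightarrow> w s < c \<Longrightarrow> 0 < d s" and "0 \<le> S"
  shows "c \<le> w S"
proof (rule ccontr)
  assume "\<not> c \<le> w S"
  have "continuous_on {0..S} w"
    by (rule DERIV_continuous_on[OF DERIV_subset[OF deriv]]) auto
  then obtain m where m: "m \<in> {0..S}" "\<And>s. s \<in> {0..S} \<Longrightarrow> w m \<le> w s"
    using continuous_attains_inf[of "{0..S}" w] \<open>0 \<le> S\<close> by auto
  have "w m < c" using m(2)[of S] \<open>0 \<le> S\<close> \<open>\<not> c \<le> w S\<close> by auto
  then have "0 < m" using m(1) \<open>c \<le> w 0\<close> by (cases "m = 0") auto
  obtain e where e: "e > 0" "\<And>h. 0 < h \<Longrightarrow> m - h \<in> {0..} \<Longrightarrow> h < e \<Longrightarrow> w (m - h) < w m"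
    using has_real_derivative_pos_inc_left[OF deriv pos] m(1) \<open>w m < c\<close> by auto
  \<comment> \<open>\<open>h \<le> m\<close> keeps \<open>m - h\<close> in the interval, and
    \<open>h \<le> e / 2\<close> keeps \<open>h\<close> below \<open>e\<close>.\<close>
  define h where "h = min m (e / 2)"
  have "w (m - h) < w m"
    by (rule e(2)) (use \<open>0 < m\<close> e(1) in \<open>auto simp: h_def\<close>)
  moreover have "w m \<le> w (m - h)"
    by (rule m(2)) (use m(1) e(1) \<open>0 < m\<close> in \<open>auto simp: h_def\<close>)
  ultimately show False by simp
qed

lemma barrier_upper:
  fixes w d :: "real \<Rightarrow> real"
  assumes deriv: "\<And>s. 0 \<le> s \<Longrightarrow> (w has_real_derivative d s) (at s within {0..})"
    and "w 0 \<le> c" and "\<And>s. 0 \<le> s \<Longrightarrow> c < w s \<Longrightarrow> d s < 0" and "0 \<le> S"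
  shows "w S \<le> c"
  using barrier_lower[of "\<lambda>s. - w s" "\<lambda>s. - d s" "- c" S] assms by (auto intro: DERIV_minus)

section \<open>Differentiability of the solution in the transversal variable\<close>

text \<open>Differentiability in \<open>x\<close> is derived, not assumed: divided differences of
  \<open>F\<close>, of \<open>v\<close> and of the initial data feed a linear equation with
  parameter \<open>(x', x)\<close>, whose solution \<open>W\<close> extends the difference quotient
  of \<open>u\<close> continuously to the diagonal. Its value there is the derivative
  \<open>p\<close>.\<close>

lemma parametric_ode_C1:
  fixes F Fv Fu u v w :: "real \<Rightarrow> real \<Rightarrow> real"
  assumes Fv_cont: "continuous_on ({0<..} \<times> {0<..}) (\<lambda>(a, b). Fv a b)"
    and Fu_cont: "continuous_on ({0<..} \<times> {0<..}) (\<lambda>(a, b). Fu a b)"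
    and dFv: "\<And>a b. 0 < a \<Longrightarrow> 0 < b \<Longrightarrow> ((\<lambda>a. F a b) has_real_derivative Fv a b) (at a)"
    and dFu: "\<And>a b. 0 < a \<Longrightarrow> 0 < b \<Longrightarrow> (F a has_real_derivative Fu a b) (at b)"
    and u_cont: "continuous_on ({0..} \<times> {0..}) (\<lambda>(x, s). u x s)"
    and v_cont: "continuous_on ({0..} \<times> {0..}) (\<lambda>(x, s). v x s)"
    and w_cont: "continuous_on ({0..} \<times> {0..}) (\<lambda>(x, s). w x s)"
    and pos: "\<And>x s. 0 \<le> x \<Longrightarrow> 0 \<le> s \<Longrightarrow> 0 < u x s \<and> 0 < v x s"
    and du: "\<And>x s. 0 \<le> x \<Longrightarrow> 0 \<le> s \<Longrightarrow>
               (u x has_real_derivative F (v x s) (u x s)) (at s within {0..})"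
    and dv: "\<And>x s. 0 \<le> x \<Longrightarrow> 0 \<le> s \<Longrightarrow>
               ((\<lambda>x. v x s) has_real_derivative w x s) (at x within {0..})"
    and u0_cont: "continuous_on {0..} u0'"
    and du0: "\<And>x. 0 \<le> x \<Longrightarrow> ((\<lambda>x. u x 0) has_real_derivative u0' x) (at x within {0..})"
    and "0 \<le> B" "0 \<le> D" "0 \<le> S"
    and u0_bound: "\<And>x. 0 \<le> x \<Longrightarrow> \<bar>u0' x\<bar> \<le> A"
    and Fu_bound: "\<And>x s. 0 \<le> x \<Longrightarrow> 0 \<le> s \<Longrightarrow> \<bar>Fu (v x s) (u x s)\<bar> \<le> B"
    and Fv_bound: "\<And>x s. 0 \<le> x \<Longrightarrow> 0 \<le> s \<Longrightarrow> \<bar>Fv (v x s) (u x s)\<bar> \<le> B"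
    and w_bound: "\<And>x s. 0 \<le> x \<Longrightarrow> 0 \<le> s \<Longrightarrow> \<bar>w x s\<bar> \<le> D"
  obtains p where "continuous_on {0..} p"
    and "\<And>x. 0 \<le> x \<Longrightarrow> ((\<lambda>x. u x S) has_real_derivative p x) (at x within {0..})"
    and "\<And>x. 0 \<le> x \<Longrightarrow> \<bar>p x\<bar> \<le> exp (3 / 2 * B * S) * (A + D)"
proof -
  let ?P = "{0<..} :: real set" and ?H = "{0..} :: real set"
  obtain \<kappa>u where \<kappa>u: "continuous_on (?P \<times> ?P \<times> ?P) (\<lambda>(c, a, b). \<kappa>u c a b)"
      "\<And>c a b. c \<in> ?P \<Longrightarrow> a \<in> ?P \<Longrightarrow> b \<in> ?P \<Longrightarrow> F c a - F c b = \<kappa>u c a b * (a - b)"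
      "\<And>c a. c \<in> ?P \<Longrightarrow> a \<in> ?P \<Longrightarrow> \<kappa>u c a a = Fu c a"
    by (rule hadamard_divided_difference[OF _ Fu_cont, where K = F])
       (use dFu in \<open>auto intro: has_field_derivative_at_within\<close>)
  \<comment> \<open>The variable to be differenced comes last, so the arguments of \<open>F\<close>
    are exchanged here, and likewise those of \<open>v\<close> below.\<close>
  obtain \<kappa>v where \<kappa>v: "continuous_on (?P \<times> ?P \<times> ?P) (\<lambda>(c, a, b). \<kappa>v c a b)"
      "\<And>c a b. c \<in> ?P \<Longrightarrow> a \<in> ?P \<Longrightarrow> b \<in> ?P \<Longrightarrow> F a c - F b c = \<kappa>v c a b * (a - b)"
      "\<And>c a. c \<in> ?P \<Longrightarrow> a \<in> ?P \<Longrightarrow> \<kappa>v c a a = Fv a c"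
    by (rule hadamard_divided_difference[OF _ continuous_on_swap_args[OF Fv_cont], where K = "\<lambda>c a. F a c"])
       (use dFv in \<open>auto intro: has_field_derivative_at_within\<close>)
  obtain \<kappa>w where \<kappa>w: "continuous_on (?H \<times> ?H \<times> ?H) (\<lambda>(c, a, b). \<kappa>w c a b)"
      "\<And>c a b. c \<in> ?H \<Longrightarrow> a \<in> ?H \<Longrightarrow> b \<in> ?H \<Longrightarrow> v a c - v b c = \<kappa>w c a b * (a - b)"
      "\<And>c a. c \<in> ?H \<Longrightarrow> a \<in> ?H \<Longrightarrow> \<kappa>w c a a = w a c"
    by (rule hadamard_divided_difference[OF _ continuous_on_swap_args[OF w_cont], where K = "\<lambda>s x. v x s"])
       (use dv in auto)
  \<comment> \<open>The initial data carry no parameter; the singleton \<open>{0}\<close> serves as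
    a dummy parameter set.\<close>
  have "continuous_on ({0::real} \<times> ?H) (\<lambda>z::real \<times> real. u0' (snd z))"
    by (rule continuous_on_compose2[OF u0_cont]) (auto intro!: continuous_intros)
  then have "continuous_on ({0::real} \<times> ?H) (\<lambda>(_, x). u0' x)"
    by (simp add: split_beta)
  then obtain \<kappa>0 where \<kappa>0: "continuous_on ({0::real} \<times> ?H \<times> ?H) (\<lambda>(c::real, a, b). \<kappa>0 c a b)"
      "\<And>c a b. c \<in> {0::real} \<Longrightarrow> a \<in> ?H \<Longrightarrow> b \<in> ?H \<Longrightarrow> u a 0 - u b 0 = \<kappa>0 c a b * (a - b)"
      "\<And>c a. c \<in> {0::real} \<Longrightarrow> a \<in> ?H \<Longrightarrow> \<kappa>0 c a a = u0' a"
    by (rule hadamard_divided_difference[OF convex_real_interval(1), where K = "\<lambda>_ x. u x 0"])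
       (use du0 in auto)
  let ?Y = "?H \<times> ?H"
  \<comment> \<open>The parameter is \<open>y = (x', x)\<close>. On the diagonal
    \<open>\<alpha>\<close> becomes \<open>Fu\<close> and \<open>\<beta>\<close> becomes
    \<open>Fv * w\<close> along the solution, the coefficients of the linearized equation.\<close>
  define \<alpha> where "\<alpha> y s = \<kappa>u (v (fst y) s) (u (fst y) s) (u (snd y) s)" for y :: "real \<times> real" and s
  define \<beta> where "\<beta> y s = \<kappa>v (u (snd y) s) (v (fst y) s) (v (snd y) s) * \<kappa>w s (fst y) (snd y)"
    for y :: "real \<times> real" and s
  define c where "c y = \<kappa>0 0 (fst y) (snd y)" for y
  have pr: "continuous_on (?Y \<times> ?H) (\<lambda>z. fst (fst z))" "continuous_on (?Y \<times> ?H) (\<lambda>z. snd (fst z))"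
      "continuous_on (?Y \<times> ?H) snd"
    by (intro continuous_intros)+
  have along: "continuous_on (?Y \<times> ?H) (\<lambda>z. h (fst (fst z)) (snd z))"
    "continuous_on (?Y \<times> ?H) (\<lambda>z. h (snd (fst z)) (snd z))"
    if h: "continuous_on (?H \<times> ?H) (\<lambda>(x, s). h x s)" for h :: "real \<Rightarrow> real \<Rightarrow> real"
    by (rule continuous_on_compose_uncurry2[OF h pr(1,3)]; force)
      (rule continuous_on_compose_uncurry2[OF h pr(2,3)]; force)
  note cont_uv = along[OF u_cont] along[OF v_cont]
  have \<alpha>_cont: "continuous_on (?Y \<times> ?H) (\<lambda>(y, s). \<alpha> y s)"
    unfolding \<alpha>_def split_beta
    by (rule continuous_on_compose_uncurry3[OF \<kappa>u(1)]) (use cont_uv pos in auto)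
  have "continuous_on (?Y \<times> ?H) (\<lambda>z. \<kappa>v (u (snd (fst z)) (snd z)) (v (fst (fst z)) (snd z)) (v (snd (fst z)) (snd z)))"
    by (rule continuous_on_compose_uncurry3[OF \<kappa>v(1)]) (use cont_uv pos in auto)
  moreover have "continuous_on (?Y \<times> ?H) (\<lambda>z. \<kappa>w (snd z) (fst (fst z)) (snd (fst z)))"
    by (rule continuous_on_compose_uncurry3[OF \<kappa>w(1)]) (use pr in auto)
  ultimately have \<beta>_cont: "continuous_on (?Y \<times> ?H) (\<lambda>(y, s). \<beta> y s)"
    unfolding \<beta>_def split_beta by (rule continuous_on_mult)
  have c_cont: "continuous_on ?Y c"
    unfolding c_def[abs_def]
    by (rule continuous_on_compose_uncurry3[OF \<kappa>0(1)]) (auto intro!: continuous_intros)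
  obtain W where W: "continuous_on (?Y \<times> ?H) (\<lambda>(y, s). W y s)"
      "\<And>y. y \<in> ?Y \<Longrightarrow> W y 0 = c y"
      "\<And>y s. y \<in> ?Y \<Longrightarrow> 0 \<le> s \<Longrightarrow>
           (W y has_real_derivative \<alpha> y s * W y s + \<beta> y s) (at s within {0..})"
    using linear_ode_param[OF \<alpha>_cont \<beta>_cont c_cont] by blast
  \<comment> \<open>Both sides solve the same linear equation with the same initial value.
    Multiplying \<open>W\<close> by \<open>x' - x\<close>, instead of dividing the difference of
    \<open>u\<close>, admits \<open>x' = x\<close>.\<close>
  have diff: "u x' S - u x S = W (x', x) S * (x' - x)" if x: "0 \<le> x" "0 \<le> x'" for x x'
  proof (rule linear_ode_unique[where ?w1.0 = "\<lambda>s. u x' s - u x s" and ?w2.0 = "\<lambda>s. W (x', x) s * (x' - x)"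
        and a = "\<alpha> (x', x)" and b = "\<lambda>s. \<beta> (x', x) s * (x' - x)"])
    show "continuous_on ?H (\<alpha> (x', x))"
      by (rule continuous_on_compose_uncurry2[OF \<alpha>_cont]) (use x in \<open>auto intro!: continuous_intros\<close>)
    show "u x' 0 - u x 0 = W (x', x) 0 * (x' - x)"
      using W(2)[of "(x', x)"] \<kappa>0(2)[of 0 x' x] x by (simp add: c_def)
    fix s :: real assume s: "0 \<le> s"
    \<comment> \<open>The intermediate value \<open>F (v x' s) (u x s)\<close> changes one argument
      at a time: the change in \<open>u\<close> gives \<open>\<alpha>\<close>, the change in
      \<open>v\<close> gives \<open>\<beta>\<close>.\<close>
    have "F (v x' s) (u x' s) - F (v x s) (u x s)
        = (F (v x' s) (u x' s) - F (v x' s) (u x s)) + (F (v x' s) (u x s) - F (v x s) (u x s))"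
      by simp
    also have "\<dots> = \<alpha> (x', x) s * (u x' s - u x s) + \<beta> (x', x) s * (x' - x)"
      using \<kappa>u(2)[of "v x' s" "u x' s" "u x s"] \<kappa>v(2)[of "u x s" "v x' s" "v x s"]
        \<kappa>w(2)[of s x' x] pos[of x s] pos[of x' s] x s
      by (simp add: \<alpha>_def \<beta>_def)
    finally show "((\<lambda>s. u x' s - u x s) has_real_derivative
        \<alpha> (x', x) s * (u x' s - u x s) + \<beta> (x', x) s * (x' - x)) (at s within {0..})"
      using DERIV_diff[OF du[OF x(2) s] du[OF x(1) s]] by simp
    show "((\<lambda>s. W (x', x) s * (x' - x)) has_real_derivative
        \<alpha> (x', x) s * (W (x', x) s * (x' - x)) + \<beta> (x', x) s * (x' - x)) (at s within {0..})"
      using DERIV_cmult_right[OF W(3)[of "(x', x)" s], of "x' - x"] x s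
      by (simp add: algebra_simps)
  qed (fact \<open>0 \<le> S\<close>)
  have W_slice: "continuous_on ?H (\<lambda>z. W (e1 z, e2 z) S)"
    if "continuous_on ?H e1" "continuous_on ?H e2" "\<And>z. z \<in> ?H \<Longrightarrow> 0 \<le> e1 z \<and> 0 \<le> e2 z"
    for e1 e2 :: "real \<Rightarrow> real"
    by (rule continuous_on_compose_uncurry2[OF W(1)])
      (use that \<open>0 \<le> S\<close> in \<open>auto intro!: continuous_intros\<close>)
  show ?thesis
  proof (rule that[of "\<lambda>x. W (x, x) S"])
    show "continuous_on {0..} (\<lambda>x. W (x, x) S)"
      by (rule W_slice) (auto intro!: continuous_intros)
    fix x :: real assume x: "0 \<le> x"
    have "continuous_on ?H (\<lambda>x'. W (x', x) S)"
      by (rule W_slice) (use x in \<open>auto intro!: continuous_intros\<close>)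
    then have "((\<lambda>x'. W (x', x) S) \<longlongrightarrow> W (x, x) S) (at x within {0..})"
      using x by (simp add: continuous_on_def)
    \<comment> \<open>The filter excludes \<open>x' = x\<close>, so \<open>diff\<close> may be
      divided by \<open>x' - x\<close>.\<close>
    moreover have "\<forall>\<^sub>F x' in at x within {0..}. W (x', x) S = (u x' S - u x S) / (x' - x)"
      using diff x by (auto simp: eventually_at_filter)
    ultimately have "((\<lambda>x'. (u x' S - u x S) / (x' - x)) \<longlongrightarrow> W (x, x) S) (at x within {0..})"
      by (rule Lim_transform_eventually)
    then show "((\<lambda>x. u x S) has_real_derivative W (x, x) S) (at x within {0..})"
      by (simp add: has_field_derivative_iff)
    have xY: "(x, x) \<in> ?Y" using x by simp
    have "\<bar>W (x, x) S\<bar> \<le> exp (3 / 2 * B * S) * (\<bar>W (x, x) 0\<bar> + D)"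
    proof (rule linear_ode_bound[OF \<open>0 \<le> S\<close> \<open>0 \<le> B\<close> \<open>0 \<le> D\<close>])
      fix s assume "s \<in> {0..S}"
      then have s: "0 \<le> s" by simp
      show "(W (x, x) has_real_derivative \<alpha> (x, x) s * W (x, x) s + \<beta> (x, x) s) (at s within {0..})"
        using W(3)[OF xY s] .
      show "\<bar>\<alpha> (x, x) s\<bar> \<le> B"
        using \<kappa>u(3)[of "v x s" "u x s"] Fu_bound pos x s by (simp add: \<alpha>_def)
      have "\<beta> (x, x) s = Fv (v x s) (u x s) * w x s"
        using \<kappa>v(3)[of "u x s" "v x s"] \<kappa>w(3)[of s x] pos x s by (simp add: \<beta>_def)
      then show "\<bar>\<beta> (x, x) s\<bar> \<le> B * D"
        using Fv_bound[OF x s] w_bound[OF x s] by (simp add: abs_mult mult_mono)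
    qed
    also have "W (x, x) 0 = u0' x"
      using W(2)[OF xY] \<kappa>0(3)[of 0 x] x by (simp add: c_def)
    also have "exp (3 / 2 * B * S) * (\<bar>u0' x\<bar> + D) \<le> exp (3 / 2 * B * S) * (A + D)"
      using u0_bound[OF x] by simp
    finally show "\<bar>W (x, x) S\<bar> \<le> exp (3 / 2 * B * S) * (A + D)" .
  qed
qed

section \<open>Relatively elementary functions are continuously differentiable\<close>

text \<open>\<open>f1\<close> and \<open>f2\<close> are explicit partial derivatives, so that each
  closure rule computes new ones. Continuity of \<open>f\<close> is recorded too, since the quotient
  rule puts \<open>f\<close> itself into the new derivatives.\<close>

definition C1_quadrant ::
    "(real \<Rightarrow> real \<Rightarrow> real) \<Rightarrow> (real \<Rightarrow> real \<Rightarrow> real) \<Rightarrow> (real \<Rightarrow> real \<Rightarrow> real) \<Rightarrow> bool" where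
  "C1_quadrant f f1 f2 \<longleftrightarrow>
     continuous_on ({0<..} \<times> {0<..}) (\<lambda>(a, b). f1 a b) \<and>
     continuous_on ({0<..} \<times> {0<..}) (\<lambda>(a, b). f2 a b) \<and>
     continuous_on ({0<..} \<times> {0<..}) (\<lambda>(a, b). f a b) \<and>
     (\<forall>a>0. \<forall>b>0. ((\<lambda>a. f a b) has_real_derivative f1 a b) (at a) \<and>
                 (f a has_real_derivative f2 a b) (at b))"

lemma C1_quadrant_monomial:
  "C1_quadrant (\<lambda>a b. c * (a powr d * b powr e))
     (\<lambda>a b. c * (d * a powr (d - 1) * b powr e)) (\<lambda>a b. c * (a powr d * (e * b powr (e - 1))))"
  unfolding C1_quadrant_def split_beta
proof (intro conjI allI impI)
  fix a b :: real assume ab: "0 < a" "0 < b"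
  show "((\<lambda>a. c * (a powr d * b powr e)) has_real_derivative c * (d * a powr (d - 1) * b powr e)) (at a)"
    by (intro DERIV_cmult DERIV_cmult_right has_real_derivative_powr ab)
  show "((\<lambda>b. c * (a powr d * b powr e)) has_real_derivative c * (a powr d * (e * b powr (e - 1)))) (at b)"
    by (intro DERIV_cmult has_real_derivative_powr ab)
qed (auto intro!: continuous_intros)

lemma C1_quadrant_sum:
  assumes "\<And>k. k \<in> K \<Longrightarrow> C1_quadrant (f k) (f1 k) (f2 k)"
  shows "C1_quadrant (\<lambda>a b. \<Sum>k\<in>K. f k a b) (\<lambda>a b. \<Sum>k\<in>K. f1 k a b) (\<lambda>a b. \<Sum>k\<in>K. f2 k a b)"
  using assms unfolding C1_quadrant_def split_beta
  by (auto intro!: continuous_on_sum DERIV_sum)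

lemma C1_quadrant_divide:
  assumes f: "C1_quadrant f f1 f2" and g: "C1_quadrant g g1 g2"
    and nz: "\<And>a b. 0 < a \<Longrightarrow> 0 < b \<Longrightarrow> g a b \<noteq> 0"
  shows "C1_quadrant (\<lambda>a b. f a b / g a b)
     (\<lambda>a b. (f1 a b * g a b - f a b * g1 a b) / (g a b * g a b))
     (\<lambda>a b. (f2 a b * g a b - f a b * g2 a b) / (g a b * g a b))"
  unfolding C1_quadrant_def split_beta
proof (intro conjI allI impI)
  fix a b :: real assume ab: "0 < a" "0 < b"
  show "((\<lambda>a. f a b / g a b) has_real_derivative
      (f1 a b * g a b - f a b * g1 a b) / (g a b * g a b)) (at a)"
    using f g nz ab by (intro DERIV_divide) (auto simp: C1_quadrant_def)
  show "((\<lambda>b. f a b / g a b) has_real_derivative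
      (f2 a b * g a b - f a b * g2 a b) / (g a b * g a b)) (at b)"
    using f g nz ab by (intro DERIV_divide) (auto simp: C1_quadrant_def)
qed (use f g nz in \<open>auto intro!: continuous_intros simp: C1_quadrant_def split_beta\<close>)

text \<open>The formula of a relatively elementary function holds for positive arguments only.
  Positivity is an open condition, so derivatives still carry over.\<close>

lemma C1_quadrant_cong:
  assumes f: "C1_quadrant f f1 f2" and eq: "\<And>a b. 0 < a \<Longrightarrow> 0 < b \<Longrightarrow> g a b = f a b"
  shows "C1_quadrant g f1 f2"
  unfolding C1_quadrant_def
proof (intro conjI allI impI)
  show "continuous_on ({0<..} \<times> {0<..}) (\<lambda>(a, b). g a b)"
    by (rule continuous_on_eq[of _ "\<lambda>(a, b). f a b"]) (use f eq in \<open>auto simp: C1_quadrant_def\<close>)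
  fix a b :: real assume ab: "0 < a" "0 < b"
  show "((\<lambda>a. g a b) has_real_derivative f1 a b) (at a)"
    by (rule has_field_derivative_transform_within_open[of "\<lambda>a. f a b" _ _ "{0<..}"])
      (use f eq ab in \<open>auto simp: C1_quadrant_def\<close>)
  show "(g a has_real_derivative f2 a b) (at b)"
    by (rule has_field_derivative_transform_within_open[of "f a" _ _ "{0<..}"])
      (use f eq ab in \<open>auto simp: C1_quadrant_def\<close>)
qed (use f in \<open>auto simp: C1_quadrant_def\<close>)

lemma C1_quadrant_minus_snd:
  assumes "C1_quadrant f f1 f2"
  shows "C1_quadrant (\<lambda>a b. f a b - b) f1 (\<lambda>a b. f2 a b - 1)"
  using assms unfolding C1_quadrant_def split_beta
  by (auto intro!: continuous_intros derivative_eq_intros)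

lemma C1_quadrant_swap:
  assumes "C1_quadrant f f1 f2"
  shows "C1_quadrant (\<lambda>a b. f b a) (\<lambda>a b. f2 b a) (\<lambda>a b. f1 b a)"
  using assms continuous_on_swap_args unfolding C1_quadrant_def by blast

lemma relatively_elementary_C1:
  assumes "relatively_elementary t f" and "0 < t"
  obtains f1 f2 where "C1_quadrant f f1 f2"
proof -
  obtain m l :: nat and \<alpha> \<beta> :: "nat \<Rightarrow> real" and a1 a2 b1 b2 :: "nat \<Rightarrow> rat"
    where "l \<ge> 1" and f_eq: "\<And>z1 z2. z1 > 0 \<Longrightarrow> z2 > 0 \<Longrightarrow> f z1 z2 =
       (\<Sum>k=1..m. t powr \<alpha> k * (z1 powr of_rat (a1 k) * z2 powr of_rat (a2 k))) /
       (\<Sum>k=1..l. t powr \<beta> k * (z1 powr of_rat (b1 k) * z2 powr of_rat (b2 k)))"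
    using assms(1) unfolding relatively_elementary_def by blast
  \<comment> \<open>All summands are positive, and \<open>l \<ge> 1\<close> makes the sum
    nonempty.\<close>
  have "(\<Sum>k=1..l. t powr \<beta> k * (z1 powr of_rat (b1 k) * z2 powr of_rat (b2 k))) \<noteq> 0"
    if "0 < z1" "0 < z2" for z1 z2 :: real
    using that \<open>0 < t\<close> \<open>l \<ge> 1\<close> by (intro less_imp_neq[symmetric] sum_pos) auto
  from C1_quadrant_cong[OF C1_quadrant_divide[OF C1_quadrant_sum C1_quadrant_sum this] f_eq,
      OF C1_quadrant_monomial C1_quadrant_monomial]
  show ?thesis by (rule that)
qed

section \<open>One-sided partial derivatives and their norms\<close>

text \<open>A connected set with more than one point has no isolated points. This makes one-sided
  derivatives unique, so \<open>partial_x\<close> and \<open>partial_s\<close> take the value of any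
  derivative that exists.\<close>

lemma at_within_halfline_neq_bot: "0 \<le> x \<Longrightarrow> at x within {0::real..} \<noteq> bot"
proof -
  assume "0 \<le> x"
  moreover have "\<not> (\<exists>y. {0::real..} = {y})"
    using infinite_Ici[of "0::real"] by (metis finite.emptyI finite_insert)
  ultimately show ?thesis
    using connected_imp_perfect[of "{0::real..}" x] by (auto simp: trivial_limit_within)
qed

text \<open>Both directions serve later: one extracts a pointwise bound from the initial data, the
  other states the bound at level \<open>m\<close>.\<close>

lemma C0_norm_partial_x_le_iff:
  assumes "\<And>x. 0 \<le> x \<Longrightarrow> ((\<lambda>x. w x s) has_real_derivative p x) (at x within {0..})"
  shows "C0_norm ({0..} \<times> {s}) (partial_x w) \<le> ereal C \<longleftrightarrow> (\<forall>x\<ge>0. \<bar>p x\<bar> \<le> C)"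
proof -
  have "partial_x w x s = p x" if "0 \<le> x" for x
    unfolding partial_x_def using assms[OF that] at_within_halfline_neq_bot[OF that]
    by (intro vector_derivative_within) (auto simp: has_real_derivative_iff_has_vector_derivative)
  then show ?thesis
    by (auto simp: C0_norm_def SUP_le_iff)
qed

lemma C0_norm_partial_s_le:
  assumes "\<And>x s. 0 \<le> x \<Longrightarrow> 0 \<le> s \<Longrightarrow> (w x has_real_derivative p x s) (at s within {0..})"
    and "\<And>x s. 0 \<le> x \<Longrightarrow> 0 \<le> s \<Longrightarrow> \<bar>p x s\<bar> \<le> C"
  shows "C0_norm ({0..} \<times> {0..}) (partial_s w) \<le> ereal C"
proof -
  have "partial_s w x s = p x s" if "0 \<le> x" "0 \<le> s" for x s
    unfolding partial_s_def using assms(1)[OF that] at_within_halfline_neq_bot[OF that(2)]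
    by (intro vector_derivative_within) (auto simp: has_real_derivative_iff_has_vector_derivative)
  then show ?thesis
    using assms(2) by (auto simp: C0_norm_def SUP_le_iff)
qed

section \<open>Exchanging the two equations\<close>

lemma C0_norm_partial_x_swap:
  "C0_norm (S \<times> T) (partial_x (\<lambda>x s. w s x)) = C0_norm (T \<times> S) (partial_s w)"
  unfolding C0_norm_def partial_x_def partial_s_def by (rule SUP_eq) auto

lemma C0_norm_partial_s_swap:
  "C0_norm (S \<times> T) (partial_s (\<lambda>x s. w s x)) = C0_norm (T \<times> S) (partial_x w)"
  unfolding C0_norm_def partial_x_def partial_s_def by (rule SUP_eq) auto

text \<open>Transposing the quadrant and exchanging \<open>f\<close> with \<open>g\<close>, each
  with its arguments reversed, gives a system of the same form. Statements about \<open>u\<close>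
  thereby yield those about \<open>v\<close>.\<close>

lemma is_solution_swap:
  assumes "is_solution f g u v"
  shows "is_solution (\<lambda>a b. g b a) (\<lambda>a b. f b a) (\<lambda>x s. v s x) (\<lambda>x s. u s x)"
  using assms unfolding is_solution_def by (auto intro: continuous_on_swap_args)

lemma restricts_to_self_dynamics_swap:
  assumes "restricts_to_self_dynamics f g r R q"
  shows "restricts_to_self_dynamics (\<lambda>a b. g b a) (\<lambda>a b. f b a) r R q"
  using assms unfolding restricts_to_self_dynamics_def by auto

section \<open>Invariance and derivative bounds for one component\<close>

text \<open>For every positive value of \<open>v\<close>, the right-hand side is at least
  \<open>q\<close> when \<open>u \<le> r + q\<close> and at most \<open>- q\<close> when
  \<open>u \<ge> R - q\<close>. Both levels are therefore barriers.\<close>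

lemma solution_invariant:
  assumes self: "restricts_to_self_dynamics f g r R q"
    and sol: "is_solution f g u v"
    and "u x 0 \<in> {r + q..R - q}" "0 \<le> x" "0 \<le> s"
  shows "u x s \<in> {r..R}"
proof -
  have "0 < q" using self by (simp add: restricts_to_self_dynamics_def)
  have low: "q \<le> f a b - b" if "0 < a" "0 < b" "b \<le> r + q" for a b
    using self that unfolding restricts_to_self_dynamics_def by blast
  have high: "f a b - b \<le> - q" if "0 < a" "b \<ge> R - q" for a b
    using self that unfolding restricts_to_self_dynamics_def by blast
  have du: "(u x has_real_derivative f (v x s) (u x s) - u x s) (at s within {0..})"
    and pos: "0 < u x s" "0 < v x s" if "0 \<le> s" for s
    using sol that \<open>0 \<le> x\<close> by (auto simp: is_solution_def)
  have "r + q \<le> u x s"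
  proof (rule barrier_lower[OF du _ _ \<open>0 \<le> s\<close>])
    show "0 < f (v x s) (u x s) - u x s" if "0 \<le> s" "u x s < r + q" for s
      using low[of "v x s" "u x s"] pos[of s] that \<open>0 < q\<close> by simp
  qed (use assms in auto)
  moreover have "u x s \<le> R - q"
  proof (rule barrier_upper[OF du _ _ \<open>0 \<le> s\<close>])
    show "f (v x s) (u x s) - u x s < 0" if "0 \<le> s" "R - q < u x s" for s
      using high[of "v x s" "u x s"] pos[of s] that \<open>0 < q\<close> by simp
  qed (use assms in auto)
  ultimately show ?thesis using \<open>0 < q\<close> by simp
qed

text \<open>From \<open>exp (1 / 2) \<le> 2\<close> follows \<open>1 / 2 \<le> ln 2\<close>, hence
  \<open>3 / 2 * B \<le> 3 / 8 * inverse \<tau> \<le> inverse \<tau> * ln 2\<close>.\<close>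

lemma exp_le_two_powr:
  fixes B \<tau> S :: real
  assumes "0 < \<tau>" "\<tau> * B \<le> 1 / 4" "0 \<le> S"
  shows "exp (3 / 2 * B * S) \<le> 2 powr (inverse \<tau> * S)"
proof -
  have "1 / 2 \<le> ln (2::real)"
    by (subst ln_ge_iff) (use exp_half_le2 in simp_all)
  moreover have "B \<le> inverse \<tau> * (1 / 4)"
    using assms by (simp add: field_simps)
  moreover have "inverse \<tau> * (1 / 2) \<le> inverse \<tau> * ln 2"
    using calculation(1) assms(1) by (intro mult_left_mono) auto
  moreover have "0 < inverse \<tau>"
    using assms(1) by simp
  ultimately have "3 / 2 * B \<le> inverse \<tau> * ln 2"
    by linarith
  then have "3 / 2 * B * S \<le> inverse \<tau> * ln 2 * S"
    using \<open>0 \<le> S\<close> by (rule mult_right_mono)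
  then show ?thesis by (simp add: powr_def mult_ac)
qed

text \<open>\<open>D\<close> and \<open>B\<close> are arbitrary numbers with pointwise bounds, so
  the lemma applies to the transposed system with the same constants.\<close>

lemma solution_component_bounds:
  assumes f: "C1_quadrant f f1 f2" and g: "C1_quadrant g g1 g2"
    and self: "restricts_to_self_dynamics f g r R q"
    and sol: "is_solution f g u v"
    and u0: "\<And>x. 0 \<le> x \<Longrightarrow> u x 0 \<in> {r + q..R - q}"
    and v0: "\<And>s. 0 \<le> s \<Longrightarrow> v 0 s \<in> {r + q..R - q}"
    and C1: "C1_halfline (\<lambda>x. u x 0)"
    and A: "C0_norm ({0..} \<times> {0}) (partial_x u) \<le> ereal A"
    and D: "\<And>a b. a \<in> {r..R} \<Longrightarrow> b \<in> {r..R} \<Longrightarrow> \<bar>f a b - b\<bar> \<le> D \<and> \<bar>g a b - a\<bar> \<le> D"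
    and B: "\<And>a b. a \<in> {r..R} \<Longrightarrow> b \<in> {r..R} \<Longrightarrow> \<bar>f2 a b - 1\<bar> \<le> B \<and> \<bar>f1 a b\<bar> \<le> B"
    and \<tau>: "0 < \<tau>" "\<tau> * B \<le> 1 / 4"
  shows "C1_halfline (\<lambda>x. u x (real m))"
    and "C0_norm ({0..} \<times> {real m}) (partial_x u)
           \<le> ereal (2 powr (inverse \<tau> * real m) * (A + 2 * D))"
    and "C0_norm ({0..} \<times> {0..}) (partial_s u) \<le> ereal D"
proof -
  have "r < R" using self by (simp add: restricts_to_self_dynamics_def)
  then have "0 \<le> D" "0 \<le> B"
    using D[of r r] B[of r r] by auto
  have u_mem: "u x s \<in> {r..R}" if "0 \<le> x" "0 \<le> s" for x s
    using solution_invariant[OF self sol u0 that] that by simp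
  \<comment> \<open>In the transposed system \<open>v\<close> is the first unknown, so the
    invariance result covers it with \<open>x\<close> and \<open>s\<close> exchanged.\<close>
  have v_mem: "v x s \<in> {r..R}" if "0 \<le> x" "0 \<le> s" for x s
    using solution_invariant[OF restricts_to_self_dynamics_swap[OF self] is_solution_swap[OF sol],
        of s x] v0 that by simp
  note F = C1_quadrant_minus_snd[OF f, unfolded C1_quadrant_def]
  have u_cont: "continuous_on ({0..} \<times> {0..}) (\<lambda>(x, s). u x s)"
    and v_cont: "continuous_on ({0..} \<times> {0..}) (\<lambda>(x, s). v x s)"
    using sol by (auto simp: is_solution_def)
  have pos: "0 < u x s \<and> 0 < v x s"
    and du: "(u x has_real_derivative f (v x s) (u x s) - u x s) (at s within {0..})"
    and dv: "((\<lambda>x. v x s) has_real_derivative g (v x s) (u x s) - v x s) (at x within {0..})"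
    if "0 \<le> x" "0 \<le> s" for x s
    using sol that by (auto simp: is_solution_def)
  have "continuous_on ({0<..} \<times> {0<..}) (\<lambda>(a, b). g a b)"
    using g by (simp add: C1_quadrant_def)
  from continuous_on_compose_uncurry2[OF this v_cont[unfolded split_beta] u_cont[unfolded split_beta]]
  have "continuous_on ({0..} \<times> {0..}) (\<lambda>z. g (v (fst z) (snd z)) (u (fst z) (snd z)))"
    using pos by (simp add: mem_Times_iff)
  then have w_cont: "continuous_on ({0..} \<times> {0..}) (\<lambda>(x, s). g (v x s) (u x s) - v x s)"
    using v_cont by (auto intro!: continuous_intros simp: split_beta)
  obtain u0' where u0_cont: "continuous_on {0..} u0'"
    and du0: "\<And>x. 0 \<le> x \<Longrightarrow> ((\<lambda>x. u x 0) has_real_derivative u0' x) (at x within {0..})"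
    using C1 unfolding C1_halfline_def by blast
  have u0_bound: "\<bar>u0' x\<bar> \<le> A" if "0 \<le> x" for x
    using iffD1[OF C0_norm_partial_x_le_iff[where w = u and s = 0, OF du0] A] that by blast
  obtain p where p: "continuous_on {0..} p"
      "\<And>x. 0 \<le> x \<Longrightarrow> ((\<lambda>x. u x (real m)) has_real_derivative p x) (at x within {0..})"
      "\<And>x. 0 \<le> x \<Longrightarrow> \<bar>p x\<bar> \<le> exp (3 / 2 * B * real m) * (A + D)"
    by (rule parametric_ode_C1[where F = "\<lambda>a b. f a b - b" and Fv = f1 and Fu = "\<lambda>a b. f2 a b - 1"
          and u = u and v = v and w = "\<lambda>x s. g (v x s) (u x s) - v x s" and u0' = u0'
          and A = A and B = B and D = D and S = "real m"])
      (use F u_cont v_cont w_cont pos du dv u0_cont du0 \<open>0 \<le> D\<close> \<open>0 \<le> B\<close> u0_bound B D u_mem v_mem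
        in \<open>(simp; fail) | blast\<close>)+
  show "C1_halfline (\<lambda>x. u x (real m))"
    unfolding C1_halfline_def using p(1,2) by blast
  \<comment> \<open>Nonnegativity of \<open>A\<close> and \<open>D\<close> permits multiplying the
    two estimates and enlarging \<open>A + D\<close> to \<open>A + 2 * D\<close>.\<close>
  have "0 \<le> A" using u0_bound[of 0] by simp
  have "exp (3 / 2 * B * real m) * (A + D) \<le> 2 powr (inverse \<tau> * real m) * (A + 2 * D)"
    by (intro mult_mono exp_le_two_powr \<tau>) (use \<open>0 \<le> A\<close> \<open>0 \<le> D\<close> in auto)
  then have "\<forall>x\<ge>0. \<bar>p x\<bar> \<le> 2 powr (inverse \<tau> * real m) * (A + 2 * D)"
    using p(3) order_trans by blast
  then show "C0_norm ({0..} \<times> {real m}) (partial_x u)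
      \<le> ereal (2 powr (inverse \<tau> * real m) * (A + 2 * D))"
    using C0_norm_partial_x_le_iff[of u "real m" p, OF p(2)] by simp
  show "C0_norm ({0..} \<times> {0..}) (partial_s u) \<le> ereal D"
    by (rule C0_norm_partial_s_le[OF du]) (use D u_mem v_mem in auto)
qed

section \<open>Pointwise bounds from the suprema, and both components together\<close>

text \<open>\<open>h\<close> is the expression under the supremum, such as one with
  \<open>deriv\<close>, and \<open>k\<close> an explicit continuous function equal to it on the
  quadrant. Compactness of the square bounds the values, so the real supremum is an upper
  bound.\<close>

lemma SUP_square_upper:
  fixes h k :: "real \<Rightarrow> real \<Rightarrow> real"
  assumes "continuous_on ({0<..} \<times> {0<..}) (\<lambda>(a, b). k a b)" "0 < r"
    and eq: "\<And>a b. 0 < a \<Longrightarrow> 0 < b \<Longrightarrow> h a b = k a b"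
  shows "bdd_above ((\<lambda>(a, b). h a b) ` ({r..R} \<times> {r..R}))"
    and "a \<in> {r..R} \<Longrightarrow> b \<in> {r..R} \<Longrightarrow> k a b \<le> (SUP (a, b)\<in>{r..R} \<times> {r..R}. h a b)"
proof -
  have im: "(\<lambda>(a, b). h a b) ` ({r..R} \<times> {r..R}) = (\<lambda>(a, b). k a b) ` ({r..R} \<times> {r..R})"
    using eq \<open>0 < r\<close> by (intro image_cong) auto
  have "continuous_on ({r..R} \<times> {r..R}) (\<lambda>(a, b). k a b)"
    by (rule continuous_on_subset[OF assms(1)]) (use \<open>0 < r\<close> in auto)
  then show bdd: "bdd_above ((\<lambda>(a, b). h a b) ` ({r..R} \<times> {r..R}))"
    unfolding im
    by (intro bounded_imp_bdd_above compact_imp_bounded compact_continuous_image compact_Times) auto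
  assume "a \<in> {r..R}" "b \<in> {r..R}"
  then show "k a b \<le> (SUP (a, b)\<in>{r..R} \<times> {r..R}. h a b)"
    using cSUP_upper[OF _ bdd, of "(a, b)"] eq[of a b] \<open>0 < r\<close> by auto
qed

lemma D_const_upper:
  assumes f: "C1_quadrant f f1 f2" and g: "C1_quadrant g g1 g2" and "0 < r"
    and ab: "a \<in> {r..R}" "b \<in> {r..R}"
  shows "\<bar>f a b - b\<bar> \<le> D_const f g r R" and "\<bar>g a b - a\<bar> \<le> D_const f g r R"
proof -
  have cf: "continuous_on ({0<..} \<times> {0<..}) (\<lambda>(a, b). \<bar>f a b - b\<bar>)"
    and cg: "continuous_on ({0<..} \<times> {0<..}) (\<lambda>(a, b). \<bar>g a b - a\<bar>)"
    using f g by (auto intro!: continuous_intros simp: C1_quadrant_def split_beta)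
  have "bdd_above ((\<lambda>(v, u). \<bar>f v u - u\<bar>) ` ({r..R} \<times> {r..R}) \<union>
                   (\<lambda>(v, u). \<bar>g v u - v\<bar>) ` ({r..R} \<times> {r..R}))"
    using SUP_square_upper(1)[OF cf \<open>0 < r\<close> refl] SUP_square_upper(1)[OF cg \<open>0 < r\<close> refl] by simp
  then show "\<bar>f a b - b\<bar> \<le> D_const f g r R" and "\<bar>g a b - a\<bar> \<le> D_const f g r R"
    unfolding D_const_def using ab by (auto intro!: cSup_upper)
qed

lemma B_const_upper:
  assumes f: "C1_quadrant f f1 f2" and g: "C1_quadrant g g1 g2" and "0 < r"
    and ab: "a \<in> {r..R}" "b \<in> {r..R}"
  shows "\<bar>f2 a b - 1\<bar> \<le> B_const f g r R" "\<bar>f1 a b\<bar> \<le> B_const f g r R"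
    "\<bar>g1 a b - 1\<bar> \<le> B_const f g r R" "\<bar>g2 a b\<bar> \<le> B_const f g r R"
proof -
  have deriv: "deriv (\<lambda>u'. f a u') b = f2 a b" "deriv (\<lambda>v'. f v' b) a = f1 a b"
    "deriv (\<lambda>u'. g a u') b = g2 a b" "deriv (\<lambda>v'. g v' b) a = g1 a b"
    if "0 < a" "0 < b" for a b
    using f g that by (auto intro!: DERIV_imp_deriv simp: C1_quadrant_def)
  have cont: "continuous_on ({0<..} \<times> {0<..}) (\<lambda>(a, b). \<bar>f2 a b - 1\<bar>)"
    "continuous_on ({0<..} \<times> {0<..}) (\<lambda>(a, b). \<bar>f1 a b\<bar>)"
    "continuous_on ({0<..} \<times> {0<..}) (\<lambda>(a, b). \<bar>g1 a b - 1\<bar>)"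
    "continuous_on ({0<..} \<times> {0<..}) (\<lambda>(a, b). \<bar>g2 a b\<bar>)"
    using f g by (auto intro!: continuous_intros simp: C1_quadrant_def split_beta)
  have "\<bar>f2 a b - 1\<bar> \<le> (SUP (v,u)\<in>{r..R} \<times> {r..R}. \<bar>deriv (\<lambda>u'. f v u') u - 1\<bar>)"
    by (rule SUP_square_upper(2)[OF cont(1) \<open>0 < r\<close> _ ab]) (simp add: deriv)
  then show "\<bar>f2 a b - 1\<bar> \<le> B_const f g r R"
    unfolding B_const_def by (rule order_trans) (rule Max_ge, auto)
  have "\<bar>f1 a b\<bar> \<le> (SUP (v,u)\<in>{r..R} \<times> {r..R}. \<bar>deriv (\<lambda>v'. f v' u) v\<bar>)"
    by (rule SUP_square_upper(2)[OF cont(2) \<open>0 < r\<close> _ ab]) (simp add: deriv)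
  then show "\<bar>f1 a b\<bar> \<le> B_const f g r R"
    unfolding B_const_def by (rule order_trans) (rule Max_ge, auto)
  have "\<bar>g1 a b - 1\<bar> \<le> (SUP (v,u)\<in>{r..R} \<times> {r..R}. \<bar>deriv (\<lambda>v'. g v' u) v - 1\<bar>)"
    by (rule SUP_square_upper(2)[OF cont(3) \<open>0 < r\<close> _ ab]) (simp add: deriv)
  then show "\<bar>g1 a b - 1\<bar> \<le> B_const f g r R"
    unfolding B_const_def by (rule order_trans) (rule Max_ge, auto)
  have "\<bar>g2 a b\<bar> \<le> (SUP (v,u)\<in>{r..R} \<times> {r..R}. \<bar>deriv (\<lambda>u'. g v u') u\<bar>)"
    by (rule SUP_square_upper(2)[OF cont(4) \<open>0 < r\<close> _ ab]) (simp add: deriv)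
  then show "\<bar>g2 a b\<bar> \<le> B_const f g r R"
    unfolding B_const_def by (rule order_trans) (rule Max_ge, auto)
qed

theorem proposition5p9:
  fixes t r R q A \<tau> :: real
    and f g u v :: "real \<Rightarrow> real \<Rightarrow> real"
  assumes "t > 1"
    and "relatively_elementary t f" and "relatively_elementary t g"
    and "restricts_to_self_dynamics f g r R q"
    and "is_solution f g u v"
    and "\<forall>x\<ge>0. u x 0 \<in> {r + q..R - q}"
    and "\<forall>s\<ge>0. v 0 s \<in> {r + q..R - q}"
    and "C1_halfline (\<lambda>x. u x 0)" and "C1_halfline (\<lambda>s. v 0 s)"
    and "C0_norm ({0..} \<times> {0}) (partial_x u) \<le> ereal A"
    and "C0_norm ({0} \<times> {0..}) (partial_s v) \<le> ereal A"
    and "\<tau> > 0"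
    and "\<tau> * Lip_const f g r R \<le> 1 / 2"
    and "\<tau> \<le> inverse (D_const f g r R) * q"
    and "\<tau> * B_const f g r R \<le> 1 / 4"
  shows "(\<forall>m::nat.
            C1_halfline (\<lambda>x. u x (real m)) \<and> C1_halfline (\<lambda>s. v (real m) s) \<and>
            C0_norm ({0..} \<times> {real m}) (partial_x u)
              \<le> ereal (2 powr (inverse \<tau> * real m) * (A + 2 * D_const f g r R)) \<and>
            C0_norm ({real m} \<times> {0..}) (partial_s v)
              \<le> ereal (2 powr (inverse \<tau> * real m) * (A + 2 * D_const f g r R))) \<and>
         C0_norm ({0..} \<times> {0..}) (partial_s u) \<le> ereal (D_const f g r R) \<and>
         C0_norm ({0..} \<times> {0..}) (partial_x v) \<le> ereal (D_const f g r R)"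
proof -
  obtain f1 f2 where f: "C1_quadrant f f1 f2"
    using relatively_elementary_C1[OF assms(2)] \<open>t > 1\<close> by force
  obtain g1 g2 where g: "C1_quadrant g g1 g2"
    using relatively_elementary_C1[OF assms(3)] \<open>t > 1\<close> by force
  have "0 < r" using assms(4) by (simp add: restricts_to_self_dynamics_def)
  note bounds = D_const_upper[OF f g \<open>0 < r\<close>] B_const_upper[OF f g \<open>0 < r\<close>]
  have u0: "\<And>x. 0 \<le> x \<Longrightarrow> u x 0 \<in> {r + q..R - q}"
    and v0: "\<And>s. 0 \<le> s \<Longrightarrow> v 0 s \<in> {r + q..R - q}"
    using assms(6,7) by blast+
  note U = solution_component_bounds[OF f g assms(4,5) u0 v0 assms(8,10)
      conjI[OF bounds(1,2)] conjI[OF bounds(3,4)] assms(12,15)]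
  have "C0_norm ({0..} \<times> {0}) (partial_x (\<lambda>x s. v s x)) \<le> ereal A"
    using assms(11) by (simp only: C0_norm_partial_x_swap)
  \<comment> \<open>In the transposed system the data of \<open>v\<close> on \<open>x = 0\<close>
    become the initial data of the first unknown. \<open>D_const\<close> and \<open>B_const\<close>
    bound both equations, so the same numbers serve, with the pointwise bounds taken from
    \<open>g\<close>.\<close>
  note V = solution_component_bounds[OF C1_quadrant_swap[OF g] C1_quadrant_swap[OF f]
      restricts_to_self_dynamics_swap[OF assms(4)] is_solution_swap[OF assms(5)] v0 u0 assms(9) this
      conjI[OF bounds(2,1)] conjI[OF bounds(5,6)] assms(12,15)]
  show ?thesis
    using U V(1) V(2)[unfolded C0_norm_partial_x_swap] V(3)[unfolded C0_norm_partial_s_swap]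
    by blast
qed

end
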